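(* Let $\mathbb D=\langle D,\leq_{\mathbb D}\rangle$ be a directed set such that Player II has no winning strategy in the game $\mathcal G(\mathbb D)$. If $\mathbb I$ is an inverse system of sets over $\mathbb D$ whose inverse limit $A_{\mathbb I}$ is non-empty, then the inverse limit $G_{\mathbb I_{gr}}$ is a free group of cardinality $\max\{\aleph_0,|A_{\mathbb I}|\}$.
   Context: A directed set is a pair $\langle D,\leq_{\mathbb D}\rangle$ with $\leq_{\mathbb D}$ reflexive and transitive on $D$ such that any two elements have a common upper bound. An inverse system of sets over $\mathbb D$ is $\mathbb I=\langle\langle A_p: p\in D\rangle,\langle f_{p,q}: p\leq_{\mathbb D} q\rangle\rangle$ with each $A_p$ non-empty, $f_{p,q}:A_q\to A_p$, $f_{p,p}=\mathrm{id}$, $f_{p,q}\circ f_{q,r}=f_{p,r}$ for $p\leq q\leq r$; its inverse limit is $A_{\mathbb I}=\{(a_p)_{p\in D}: f_{p,q}(a_q)=a_p\text{ for all }p\leq_{\mathbb D} q\}$. $\mathbb I_{gr}$ is the inverse system of groups where $G_p$ is the free group on generators $\{x_{p,a}: a\in A_p\}$ and $h_{p,q}:G_q\to G_p$ is the homomorphism with $h_{p,q}(x_{q,a})=x_{p,f_{p,q}(a)}$; its inverse limit is $G_{\mathbb I_{gr}}=\{(g_p)\in\prod_p G_p: h_{p,q}(g_q)=g_p\text{ for all }p\leq_{\mathbb D} q\}$. The game $\mathcal G(\mathbb D)$: in round $i<\omega$, Player I chooses $p_{2i}\in D$ and then Player II chooses $p_{2i+1}\in D$. Player I wins the run $(p_i)_{i<\omega}$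 iff either there is $i$ with $p_{2i}\not\leq_{\mathbb D} p_{2i+1}$, or $p_{2i+1}\leq_{\mathbb D}p_{2i+2}$ for all $i<\omega$ and there is $p\in D$ with $p_i\leq_{\mathbb D} p$ for all $i$. A winning strategy for Player II is a function $s:{}^{<\omega}D\to D$ such that Player II wins every run with $s(\langle p_0,\dots,p_{2i}\rangle)=p_{2i+1}$ for all $i$. *)

theory Defs
  imports "HOL-Algebra.Product_Groups"
begin

unbundle cardinal_syntax

section \<open>Free groups\<close>

text \<open>
  The letter \<open>(a, True)\<close> is the generator \<open>x\<^sub>a\<close>, and \<open>(a, False)\<close> is its inverse.
  The free group on \<open>X\<close> consists of the reduced words over \<open>X\<close>; multiplying is
  pushing the letters of the left factor onto the right one, cancelling where possible.
\<close>

definition inv_letter :: "'a \<times> bool \<Rightarrow> 'a \<times> bool" where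
  "inv_letter x = (fst x, \<not> snd x)"

definition reduced :: "('a \<times> bool) list \<Rightarrow> bool" where
  "reduced w \<longleftrightarrow> successively (\<lambda>x y. y \<noteq> inv_letter x) w"

fun push_letter :: "'a \<times> bool \<Rightarrow> ('a \<times> bool) list \<Rightarrow> ('a \<times> bool) list" where
  "push_letter x [] = [x]"
| "push_letter x (y # w) = (if y = inv_letter x then w else x # y # w)"

definition free_group :: "'a set \<Rightarrow> ('a \<times> bool) list monoid" where
  "free_group X =
    \<lparr>carrier = {w \<in> lists (X \<times> UNIV). reduced w},
     monoid.mult = (\<lambda>u v. foldr push_letter u v),
     one = []\<rparr>"

definition free_gen :: "'a \<Rightarrow> ('a \<times> bool) list" where
  "free_gen a = [(a, True)]"

definition letter_value :: "('b, 'c) monoid_scheme \<Rightarrow> ('a \<Rightarrow> 'b) \<Rightarrow> 'a \<times> bool \<Rightarrow> 'b" where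
  "letter_value G \<phi> x = (if snd x then \<phi> (fst x) else inv\<^bsub>G\<^esub> (\<phi> (fst x)))"

text \<open>
  The homomorphism out of the free group that extends a map \<open>\<phi>\<close> of the generators; see
  \<open>free_lift_hom\<close>, \<open>free_lift_gen\<close> and \<open>free_lift_unique\<close> below.
\<close>

definition free_lift ::
  "('b, 'c) monoid_scheme \<Rightarrow> ('a \<Rightarrow> 'b) \<Rightarrow> ('a \<times> bool) list \<Rightarrow> 'b" where
  "free_lift G \<phi> w = foldr (\<lambda>x y. letter_value G \<phi> x \<otimes>\<^bsub>G\<^esub> y) w \<one>\<^bsub>G\<^esub>"

definition free_basis :: "('a, 'b) monoid_scheme \<Rightarrow> 'a set \<Rightarrow> bool" where
  "free_basis G X \<longleftrightarrow> X \<subseteq> carrier G \<and> free_lift G (\<lambda>x. x) \<in> iso (free_group X) G"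

definition is_free_group :: "('a, 'b) monoid_scheme \<Rightarrow> bool" where
  "is_free_group G \<longleftrightarrow> group G \<and> (\<exists>X. free_basis G X)"

lemma inv_letter_inv_letter [simp]: "inv_letter (inv_letter x) = x"
  by (simp add: inv_letter_def)

lemma inv_letter_neq [simp]: "inv_letter x \<noteq> x" "x \<noteq> inv_letter x"
  by (auto simp: inv_letter_def prod_eq_iff)

lemma fst_inv_letter [simp]: "fst (inv_letter x) = fst x"
  by (simp add: inv_letter_def)

lemma reduced_simps [simp]:
  "reduced []" "reduced [x]"
  "reduced (x # y # w) \<longleftrightarrow> y \<noteq> inv_letter x \<and> reduced (y # w)"
  by (simp_all add: reduced_def)

lemma reduced_tl: "reduced (x # w) \<Longrightarrow> reduced w"
  by (cases w) auto

lemma reduced_push: "reduced w \<Longrightarrow> reduced (push_letter x w)"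
  by (cases w) (auto dest: reduced_tl)

lemma push_letter_reduced: "reduced (x # w) \<Longrightarrow> push_letter x w = x # w"
  by (cases w) auto

lemma reduced_foldr_push: "reduced v \<Longrightarrow> reduced (foldr push_letter u v)"
  by (induction u) (auto intro: reduced_push)

lemma push_push_inv: "reduced w \<Longrightarrow> push_letter x (push_letter (inv_letter x) w) = w"
  by (cases w) (auto simp: push_letter_reduced)

lemma foldr_push_push:
  assumes "reduced w"
  shows "foldr push_letter (push_letter x u) w = push_letter x (foldr push_letter u w)"
proof (cases u)
  case (Cons y u')
  have "push_letter x (push_letter (inv_letter x) (foldr push_letter u' w)) = foldr push_letter u' w"
    by (intro push_push_inv reduced_foldr_push assms)
  with Cons show ?thesis by auto
qed simp

lemma foldr_push_assoc:
  assumes "reduced w"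
  shows "foldr push_letter (foldr push_letter u v) w = foldr push_letter u (foldr push_letter v w)"
  by (induction u) (simp_all add: foldr_push_push assms)

lemma foldr_push_Nil: "reduced w \<Longrightarrow> foldr push_letter w [] = w"
proof (induction w)
  case (Cons x w)
  then have "foldr push_letter w [] = w" by (blast dest: reduced_tl)
  with Cons.prems show ?case by (simp add: push_letter_reduced)
qed simp

lemma push_letter_in_lists:
  "fst x \<in> X \<Longrightarrow> w \<in> lists (X \<times> UNIV) \<Longrightarrow> push_letter x w \<in> lists (X \<times> UNIV)"
  by (cases w; cases x) auto

lemma foldr_push_in_lists:
  "u \<in> lists (X \<times> UNIV) \<Longrightarrow> v \<in> lists (X \<times> UNIV) \<Longrightarrow>
    foldr push_letter u v \<in> lists (X \<times> UNIV)"
proof (induction u)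
  case (Cons x u)
  then show ?case using push_letter_in_lists[of x X "foldr push_letter u v"] by (cases x) simp
qed simp

lemma foldr_push_inverse:
  "reduced w \<Longrightarrow> foldr push_letter (map inv_letter (rev u)) (foldr push_letter u w) = w"
proof (induction u arbitrary: w)
  case (Cons x u)
  have "push_letter (inv_letter x) (push_letter x (foldr push_letter u w)) = foldr push_letter u w"
    using push_push_inv[of "foldr push_letter u w" "inv_letter x"]
    by (simp add: reduced_foldr_push Cons.prems)
  with Cons show ?case by simp
qed simp

lemma group_free_group: "group (free_group X)"
proof (rule groupI)
  fix w assume w: "w \<in> carrier (free_group X)"
  let ?v = "foldr push_letter (map inv_letter (rev w)) []"
  have "map inv_letter (rev w) \<in> lists (X \<times> UNIV)"
    using w by (fastforce simp: free_group_def inv_letter_def)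
  then have "?v \<in> carrier (free_group X)"
    using foldr_push_in_lists[of _ X "[]"] reduced_foldr_push[of "[]"]
    by (simp add: free_group_def del: in_lists_conv_set lists_image)
  moreover have "?v \<otimes>\<^bsub>free_group X\<^esub> w = \<one>\<^bsub>free_group X\<^esub>"
    using w foldr_push_inverse[of "[]" w]
    by (simp add: free_group_def foldr_push_assoc foldr_push_Nil)
  ultimately show "\<exists>v\<in>carrier (free_group X). v \<otimes>\<^bsub>free_group X\<^esub> w = \<one>\<^bsub>free_group X\<^esub>"
    by blast
qed (simp_all add: free_group_def foldr_push_assoc reduced_foldr_push foldr_push_in_lists
      del: in_lists_conv_set)

lemma free_gen_closed: "a \<in> X \<Longrightarrow> free_gen a \<in> carrier (free_group X)"
  by (simp add: free_gen_def free_group_def)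

context group
begin

lemma letter_value_closed:
  "\<phi> \<in> X \<rightarrow> carrier G \<Longrightarrow> fst x \<in> X \<Longrightarrow> letter_value G \<phi> x \<in> carrier G"
  by (auto simp: letter_value_def)

lemma free_lift_closed:
  "\<phi> \<in> X \<rightarrow> carrier G \<Longrightarrow> w \<in> lists (X \<times> UNIV) \<Longrightarrow> free_lift G \<phi> w \<in> carrier G"
proof (induction w)
  case (Cons x w)
  then show ?case using letter_value_closed[of \<phi> X x] by (cases x) (simp add: free_lift_def)
qed (simp add: free_lift_def)

lemma free_lift_Cons:
  "free_lift G \<phi> (x # w) = letter_value G \<phi> x \<otimes> free_lift G \<phi> w"
  by (simp add: free_lift_def)

lemma letter_value_inv:
  assumes "\<phi> \<in> X \<rightarrow> carrier G" "fst x \<in> X"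
  shows "letter_value G \<phi> x \<otimes> letter_value G \<phi> (inv_letter x) = \<one>"
proof -
  have "\<phi> (fst x) \<in> carrier G" using assms by auto
  then show ?thesis by (simp add: letter_value_def inv_letter_def)
qed

lemma free_lift_push:
  assumes \<phi>: "\<phi> \<in> X \<rightarrow> carrier G" and x: "fst x \<in> X" and w: "w \<in> lists (X \<times> UNIV)"
  shows "free_lift G \<phi> (push_letter x w) = letter_value G \<phi> x \<otimes> free_lift G \<phi> w"
proof (cases "\<exists>v. w = inv_letter x # v")
  case True
  then obtain v where v: "w = inv_letter x # v" by blast
  have cl: "free_lift G \<phi> v \<in> carrier G" "letter_value G \<phi> x \<in> carrier G"
    "letter_value G \<phi> (inv_letter x) \<in> carrier G"
    using w v x by (auto intro!: free_lift_closed[OF \<phi>] letter_value_closed[OF \<phi>])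
  have "letter_value G \<phi> x \<otimes> free_lift G \<phi> w =
      (letter_value G \<phi> x \<otimes> letter_value G \<phi> (inv_letter x)) \<otimes> free_lift G \<phi> v"
    using cl by (simp add: v free_lift_Cons m_assoc)
  then show ?thesis using cl v letter_value_inv[OF \<phi> x] by simp
next
  case False
  then have "push_letter x w = x # w" by (cases w) auto
  then show ?thesis by (simp add: free_lift_Cons)
qed

lemma free_lift_hom:
  assumes \<phi>: "\<phi> \<in> X \<rightarrow> carrier G"
  shows "free_lift G \<phi> \<in> hom (free_group X) G"
proof (rule homI)
  fix u assume "u \<in> carrier (free_group X)"
  then show "free_lift G \<phi> u \<in> carrier G"
    by (auto simp: free_group_def intro!: free_lift_closed[OF \<phi>])
next
  fix u v assume "u \<in> carrier (free_group X)" "v \<in> carrier (free_group X)"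
  then have u: "u \<in> lists (X \<times> UNIV)" and v: "v \<in> lists (X \<times> UNIV)"
    by (auto simp: free_group_def)
  have "free_lift G \<phi> (foldr push_letter u v) = free_lift G \<phi> u \<otimes> free_lift G \<phi> v"
    using u
  proof (induction u)
    case Nil
    show ?case using free_lift_closed[OF \<phi> v] by (simp add: free_lift_def)
  next
    case (Cons x u)
    then have x: "fst x \<in> X" and u: "u \<in> lists (X \<times> UNIV)" by auto
    show ?case
      using Cons.IH free_lift_closed[OF \<phi> v] free_lift_closed[OF \<phi> u]
        letter_value_closed[OF \<phi> x]
      by (simp add: free_lift_push[OF \<phi> x foldr_push_in_lists[OF u v]] free_lift_Cons m_assoc)
  qed
  then show "free_lift G \<phi> (u \<otimes>\<^bsub>free_group X\<^esub> v) = free_lift G \<phi> u \<otimes> free_lift G \<phi> v"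
    by (simp add: free_group_def)
qed

lemma free_lift_gen:
  "\<phi> \<in> X \<rightarrow> carrier G \<Longrightarrow> a \<in> X \<Longrightarrow> free_lift G \<phi> (free_gen a) = \<phi> a"
  using letter_value_closed[of \<phi> X "(a, True)"]
  by (simp add: free_lift_def letter_value_def free_gen_def)

lemma free_lift_unique:
  assumes h: "h \<in> hom (free_group X) G" and gen: "\<And>a. a \<in> X \<Longrightarrow> h (free_gen a) = \<phi> a"
    and w: "w \<in> carrier (free_group X)"
  shows "h w = free_lift G \<phi> w"
proof -
  interpret h: group_hom "free_group X" G h
    using h by (simp add: group_hom_def group_hom_axioms_def group_free_group is_group)
  have letter: "h [x] = letter_value G \<phi> x" if x: "fst x \<in> X" for x
  proof (cases "snd x")
    case True
    then have "[x] = free_gen (fst x)" by (simp add: free_gen_def prod_eq_iff)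
    with True x gen show ?thesis by (simp add: letter_value_def)
  next
    case False
    have mem: "[x] \<in> carrier (free_group X)"
      using x by (cases x) (auto simp: free_group_def)
    have "[x] \<otimes>\<^bsub>free_group X\<^esub> free_gen (fst x) = \<one>\<^bsub>free_group X\<^esub>"
      using False by (simp add: free_group_def free_gen_def inv_letter_def)
    then have "[x] = inv\<^bsub>free_group X\<^esub> free_gen (fst x)"
      using h.G.inv_equality[OF _ free_gen_closed[OF x] mem] by simp
    then have "h [x] = inv (h (free_gen (fst x)))"
      using h.hom_inv[OF free_gen_closed[OF x]] by simp
    with False x gen show ?thesis by (simp add: letter_value_def)
  qed
  from w show ?thesis
  proof (induction w)
    case Nil
    then show ?case using h.hom_one by (simp add: free_lift_def free_group_def)
  next
    case (Cons x w)
    then have x: "fst x \<in> X" and red: "reduced (x # w)" and w: "w \<in> carrier (free_group X)"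
      by (auto simp: free_group_def dest: reduced_tl)
    have mem: "[x] \<in> carrier (free_group X)"
      using x by (cases x) (auto simp: free_group_def)
    have "x # w = [x] \<otimes>\<^bsub>free_group X\<^esub> w"
      using red by (simp add: free_group_def push_letter_reduced)
    then have "h (x # w) = h ([x] \<otimes>\<^bsub>free_group X\<^esub> w)" by (rule arg_cong)
    also have "\<dots> = free_lift G \<phi> (x # w)"
      using h.hom_mult[OF mem w] Cons.IH[OF w] letter[OF x] by (simp add: free_lift_Cons)
    finally show ?case .
  qed
qed

end


section \<open>Directed sets and the game\<close>

text \<open>Directed sets are non-empty, so that the players have a move to make.\<close>

definition directed_set :: "'i set \<Rightarrow> ('i \<Rightarrow> 'i \<Rightarrow> bool) \<Rightarrow> bool" where
  "directed_set D leqD \<longleftrightarrow>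
    D \<noteq> {} \<and> reflp_on D leqD \<and> transp_on D leqD \<and>
    (\<forall>p\<in>D. \<forall>q\<in>D. \<exists>r\<in>D. leqD p r \<and> leqD q r)"

definition player_I_wins :: "'i set \<Rightarrow> ('i \<Rightarrow> 'i \<Rightarrow> bool) \<Rightarrow> (nat \<Rightarrow> 'i) \<Rightarrow> bool" where
  "player_I_wins D leqD p \<longleftrightarrow>
    (\<exists>i. \<not> leqD (p (2 * i)) (p (2 * i + 1))) \<or>
    ((\<forall>i. leqD (p (2 * i + 1)) (p (2 * i + 2))) \<and> (\<exists>q\<in>D. \<forall>i. leqD (p i) q))"

definition winning_strategy_II ::
  "'i set \<Rightarrow> ('i \<Rightarrow> 'i \<Rightarrow> bool) \<Rightarrow> ('i list \<Rightarrow> 'i) \<Rightarrow> bool" where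
  "winning_strategy_II D leqD s \<longleftrightarrow>
    s \<in> lists D \<rightarrow> D \<and>
    (\<forall>p. (\<forall>i. p i \<in> D) \<longrightarrow> (\<forall>i. s (map p [0..<2 * i + 1]) = p (2 * i + 1)) \<longrightarrow>
      \<not> player_I_wins D leqD p)"


section \<open>Inverse systems and their limits\<close>

definition inverse_system_sets ::
  "'i set \<Rightarrow> ('i \<Rightarrow> 'i \<Rightarrow> bool) \<Rightarrow> ('i \<Rightarrow> 'a set) \<Rightarrow> ('i \<Rightarrow> 'i \<Rightarrow> 'a \<Rightarrow> 'a) \<Rightarrow> bool" where
  "inverse_system_sets D leqD A f \<longleftrightarrow>
    (\<forall>p\<in>D. A p \<noteq> {}) \<and>
    (\<forall>p\<in>D. \<forall>q\<in>D. leqD p q \<longrightarrow> f p q \<in> A q \<rightarrow> A p) \<and>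
    (\<forall>p\<in>D. \<forall>a\<in>A p. f p p a = a) \<and>
    (\<forall>p\<in>D. \<forall>q\<in>D. \<forall>r\<in>D. leqD p q \<longrightarrow> leqD q r \<longrightarrow>
      (\<forall>a\<in>A r. f p q (f q r a) = f p r a))"

definition inverse_limit_set ::
  "'i set \<Rightarrow> ('i \<Rightarrow> 'i \<Rightarrow> bool) \<Rightarrow> ('i \<Rightarrow> 'a set) \<Rightarrow> ('i \<Rightarrow> 'i \<Rightarrow> 'a \<Rightarrow> 'a) \<Rightarrow> ('i \<Rightarrow> 'a) set"
  where
  "inverse_limit_set D leqD A f =
    {a \<in> \<Pi>\<^sub>E p\<in>D. A p. \<forall>p\<in>D. \<forall>q\<in>D. leqD p q \<longrightarrow> f p q (a q) = a p}"

definition inverse_limit_group ::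
  "'i set \<Rightarrow> ('i \<Rightarrow> 'i \<Rightarrow> bool) \<Rightarrow> ('i \<Rightarrow> 'g monoid) \<Rightarrow> ('i \<Rightarrow> 'i \<Rightarrow> 'g \<Rightarrow> 'g) \<Rightarrow> ('i \<Rightarrow> 'g) monoid"
  where
  "inverse_limit_group D leqD G h =
    (product_group D G)
      \<lparr>carrier := {g \<in> carrier (product_group D G).
        \<forall>p\<in>D. \<forall>q\<in>D. leqD p q \<longrightarrow> h p q (g q) = g p}\<rparr>"

definition gr_obj :: "('i \<Rightarrow> 'a set) \<Rightarrow> 'i \<Rightarrow> ('a \<times> bool) list monoid" where
  "gr_obj A p = free_group (A p)"

definition gr_map ::
  "('i \<Rightarrow> 'a set) \<Rightarrow> ('i \<Rightarrow> 'i \<Rightarrow> 'a \<Rightarrow> 'a) \<Rightarrow> 'i \<Rightarrow> 'i \<Rightarrow> ('a \<times> bool) list \<Rightarrow> ('a \<times> bool) list"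
  where
  "gr_map A f p q = free_lift (gr_obj A p) (\<lambda>a. free_gen (f p q a))"

end

theory Submission
  imports Defs "HOL-Library.Countable_Set_Type" "HOL-Algebra.Free_Abelian_Groups"
begin

text \<open>
  The free group on the limit of the sets maps canonically to the limit of the free groups: a word
  in compatible families goes to the family of its evaluations at the indices.  This comparison map
  is an isomorphism.

  It is injective: finitely many elements of the limit of the sets are separated by all
  sufficiently large indices, so two distinct reduced words stay distinct at some index.

  It is surjective: along \<open>g = (g\<^sub>p)\<^sub>p\<close> the word length is monotone in \<open>p\<close>, as the bonding maps act
  letterwise before cancellation.  If it were unbounded, Player II would win by always answering
  with an index at which the length exceeds the number of moves made so far.  Hence the length
  attains its maximum at some \<open>m\<close>; beyond \<open>m\<close> nothing cancels, so the \<open>k\<close>-th letters of the \<open>g\<^sub>p\<close>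
  are compatible and trace out an element of the limit of the sets.
\<close>

section \<open>Homomorphisms of free groups induced by maps of generators\<close>

lemma carrier_free_group_iff: "w \<in> carrier (free_group X) \<longleftrightarrow> fst ` set w \<subseteq> X \<and> reduced w"
  by (fastforce simp: free_group_def)

lemma mult_free_group: "u \<otimes>\<^bsub>free_group X\<^esub> v = foldr push_letter u v"
  by (simp add: free_group_def)

abbreviation map_letters :: "('a \<Rightarrow> 'b) \<Rightarrow> ('a \<times> bool) list \<Rightarrow> ('b \<times> bool) list" where
  "map_letters \<phi> \<equiv> map (map_prod \<phi> id)"

definition free_map :: "('a \<Rightarrow> 'b) \<Rightarrow> ('a \<times> bool) list \<Rightarrow> ('b \<times> bool) list" where
  "free_map \<phi> w = foldr push_letter (map_letters \<phi> w) []"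

lemma reduced_map_lettersD: "reduced (map_letters \<phi> w) \<Longrightarrow> reduced w"
  unfolding reduced_def successively_map
  by (erule successively_mono) (auto simp: inv_letter_def)

lemma reduced_map_letters_iff:
  assumes "inj_on \<phi> (fst ` set w)"
  shows "reduced (map_letters \<phi> w) \<longleftrightarrow> reduced w"
  unfolding reduced_def successively_map
  using assms by (intro successively_cong) (auto simp: inv_letter_def prod_eq_iff inj_on_eq_iff)

lemma reduced_free_map: "reduced (free_map \<phi> w)"
  by (simp add: free_map_def reduced_foldr_push)

lemma free_map_Nil [simp]: "free_map \<phi> [] = []"
  by (simp add: free_map_def)

lemma free_map_Cons: "free_map \<phi> (x # w) = push_letter (map_prod \<phi> id x) (free_map \<phi> w)"
  by (simp add: free_map_def)

lemma free_map_eq_map_letters: "reduced (map_letters \<phi> w) \<Longrightarrow> free_map \<phi> w = map_letters \<phi> w"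
  by (simp add: free_map_def foldr_push_Nil)

lemma inj_free_gen: "inj free_gen"
  by (rule injI) (simp add: free_gen_def)

lemma free_map_free_gen: "free_map \<phi> (free_gen a) = free_gen (\<phi> a)"
  by (simp add: free_map_def free_gen_def)

lemma free_map_cong:
  "(\<And>a. a \<in> fst ` set w \<Longrightarrow> \<phi> a = \<psi> a) \<Longrightarrow> free_map \<phi> w = free_map \<psi> w"
  by (induction w) (simp_all add: free_map_Cons map_prod_def split: prod.split)

lemma free_map_push_letter:
  "free_map \<phi> (push_letter x w) = push_letter (map_prod \<phi> id x) (free_map \<phi> w)"
proof (cases w)
  case (Cons y v)
  have "map_prod \<phi> id (inv_letter x) = inv_letter (map_prod \<phi> id x)"
    by (simp add: inv_letter_def prod_eq_iff)
  then show ?thesis using Cons by (simp add: free_map_Cons push_push_inv reduced_free_map)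
qed (simp add: free_map_Cons)

lemma free_map_foldr_push:
  "free_map \<phi> (foldr push_letter u v) = foldr push_letter (free_map \<phi> u) (free_map \<phi> v)"
  by (induction u)
    (simp_all add: free_map_push_letter free_map_Cons foldr_push_push reduced_free_map)

lemma free_map_comp: "free_map \<psi> (free_map \<phi> w) = free_map (\<lambda>a. \<psi> (\<phi> a)) w"
  by (induction w) (simp_all add: free_map_Cons free_map_push_letter map_prod_def split: prod.split)

lemma free_map_id: "reduced w \<Longrightarrow> free_map id w = w"
  by (simp add: free_map_def prod.map_id0 foldr_push_Nil)

lemma free_map_closed:
  assumes "\<phi> \<in> X \<rightarrow> Y" "w \<in> carrier (free_group X)"
  shows "free_map \<phi> w \<in> carrier (free_group Y)"
proof -
  have "map_letters \<phi> w \<in> lists (Y \<times> UNIV)" using assms by (fastforce simp: free_group_def)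
  then show ?thesis
    using foldr_push_in_lists[of "map_letters \<phi> w" Y "[]"] reduced_free_map[of \<phi> w]
    by (simp add: free_group_def free_map_def del: in_lists_conv_set)
qed

lemma free_map_hom: "\<phi> \<in> X \<rightarrow> Y \<Longrightarrow> free_map \<phi> \<in> hom (free_group X) (free_group Y)"
  by (rule homI) (simp_all add: free_map_closed mult_free_group free_map_foldr_push)

lemma free_map_eq_free_lift:
  assumes "\<phi> \<in> X \<rightarrow> Y" "w \<in> carrier (free_group X)"
  shows "free_map \<phi> w = free_lift (free_group Y) (\<lambda>a. free_gen (\<phi> a)) w"
  by (rule group.free_lift_unique[OF group_free_group free_map_hom]) (use assms in
    \<open>auto simp: free_map_free_gen\<close>)

lemma inj_on_free_map:
  assumes "inj_on \<phi> X"
  shows "inj_on (free_map \<phi>) (carrier (free_group X))"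
proof (rule inj_onI)
  fix u v assume uv: "u \<in> carrier (free_group X)" "v \<in> carrier (free_group X)"
    and eq: "free_map \<phi> u = free_map \<phi> v"
  have "free_map \<phi> w = map_letters \<phi> w" if "w \<in> carrier (free_group X)" for w
    using that assms
    by (auto simp: carrier_free_group_iff reduced_map_letters_iff inj_on_subset
        intro!: free_map_eq_map_letters)
  then have "map_letters \<phi> u = map_letters \<phi> v" using uv eq by simp
  moreover have "inj_on (map_prod \<phi> id) (X \<times> UNIV)"
    using map_prod_inj_on[OF assms inj_on_id[of UNIV]] .
  moreover have "set u \<union> set v \<subseteq> X \<times> UNIV"
    using uv by (fastforce simp: carrier_free_group_iff)
  ultimately show "u = v" using map_inj_on inj_on_subset by blast
qed

lemma free_map_iso:
  assumes "inj_on \<phi> X"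
  shows "free_map \<phi> \<in> iso (free_group X) (free_group (\<phi> ` X))"
proof (rule isoI)
  show "free_map \<phi> \<in> hom (free_group X) (free_group (\<phi> ` X))" by (rule free_map_hom) auto
  have "w \<in> free_map \<phi> ` carrier (free_group X)" if w: "w \<in> carrier (free_group (\<phi> ` X))" for w
  proof
    let ?v = "free_map (inv_into X \<phi>) w"
    have "free_map \<phi> ?v = free_map id w"
      unfolding free_map_comp using w
      by (intro free_map_cong) (auto simp: carrier_free_group_iff f_inv_into_f subset_iff)
    then show "w = free_map \<phi> ?v" using w by (simp add: free_map_id carrier_free_group_iff)
    show "?v \<in> carrier (free_group X)"
      by (rule free_map_closed[OF _ w]) (auto intro: inv_into_into)
  qed
  moreover have "free_map \<phi> w \<in> carrier (free_group (\<phi> ` X))" if "w \<in> carrier (free_group X)" for w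
    using that by (rule free_map_closed[rotated]) auto
  ultimately show "bij_betw (free_map \<phi>) (carrier (free_group X)) (carrier (free_group (\<phi> ` X)))"
    using inj_on_free_map[OF assms] by (auto simp: bij_betw_def)
qed

lemma (in group) free_lift_free_map_eq_hom:
  assumes h: "h \<in> hom (free_group X) G" and w: "w \<in> carrier (free_group X)"
  shows "free_lift G (\<lambda>x. x) (free_map (h \<circ> free_gen) w) = h w"
proof -
  let ?\<phi> = "h \<circ> free_gen" and ?lift = "free_lift G (\<lambda>x. x)"
  have id: "(\<lambda>x. x) \<in> ?\<phi> ` X \<rightarrow> carrier G"
    using hom_in_carrier[OF h free_gen_closed] by auto
  have comp_hom: "?lift \<circ> free_map ?\<phi> \<in> hom (free_group X) G"
    by (rule Group.hom_compose[OF free_map_hom free_lift_hom[OF id]]) auto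
  have "(?lift \<circ> free_map ?\<phi>) w = free_lift G ?\<phi> w"
    by (rule free_lift_unique[OF comp_hom _ w])
      (simp add: free_map_free_gen free_lift_gen[OF id])
  also have "\<dots> = h w"
    by (rule free_lift_unique[OF h _ w, symmetric]) simp
  finally show ?thesis by simp
qed

lemma is_free_group_if_iso:
  assumes G: "group G" and h: "h \<in> iso (free_group X) G"
  shows "is_free_group G"
proof -
  interpret group G by (rule G)
  let ?\<phi> = "h \<circ> free_gen" and ?lift = "free_lift G (\<lambda>x. x)"
  have hom: "h \<in> hom (free_group X) G"
    and bij: "bij_betw h (carrier (free_group X)) (carrier G)"
    using h by (simp_all add: iso_def)
  have gens: "free_gen ` X \<subseteq> carrier (free_group X)" by (auto intro: free_gen_closed)
  have basis: "?\<phi> ` X \<subseteq> carrier G"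
    by (auto intro: hom_in_carrier[OF hom] free_gen_closed)
  have "inj_on ?\<phi> X"
    by (rule comp_inj_on[OF inj_on_subset[OF inj_free_gen subset_UNIV]
          inj_on_subset[OF bij_betw_imp_inj_on[OF bij] gens]])
  then have "free_map ?\<phi> \<in> iso (free_group X) (free_group (?\<phi> ` X))" by (rule free_map_iso)
  then have "bij_betw (free_map ?\<phi>) (carrier (free_group X)) (carrier (free_group (?\<phi> ` X)))"
    by (simp only: iso_def mem_Collect_eq)
  moreover have "bij_betw (?lift \<circ> free_map ?\<phi>) (carrier (free_group X)) (carrier G)"
    using bij by (subst bij_betw_cong[of _ _ h]) (simp_all add: free_lift_free_map_eq_hom[OF hom])
  ultimately have "bij_betw ?lift (carrier (free_group (?\<phi> ` X))) (carrier G)"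
    by (rule bij_betw_comp_iff[THEN iffD2])
  moreover have "?lift \<in> hom (free_group (?\<phi> ` X)) G" using basis by (intro free_lift_hom) blast
  ultimately have "free_basis G (?\<phi> ` X)" using basis by (simp only: free_basis_def iso_def) blast
  then show ?thesis using G by (auto simp: is_free_group_def)
qed

lemma length_push_letter_le: "length (push_letter x w) \<le> Suc (length w)"
  by (cases w) auto

lemma length_foldr_push_le: "length (foldr push_letter u v) \<le> length u + length v"
proof (induction u)
  case (Cons x u)
  then show ?case using length_push_letter_le[of x "foldr push_letter u v"] by simp
qed simp

lemma foldr_push_Nil_eq_if_length_eq:
  "length (foldr push_letter u []) = length u \<Longrightarrow> foldr push_letter u [] = u"
proof (induction u)
  case (Cons x u)
  have "length (foldr push_letter u []) = length u"
    using Cons.prems length_push_letter_le[of x "foldr push_letter u []"]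
      length_foldr_push_le[of u "[]"] by simp
  then have "foldr push_letter u [] = u" by (rule Cons.IH)
  with Cons.prems show ?case by (cases u) (auto split: if_splits)
qed simp

lemma length_free_map_le: "length (free_map \<phi> w) \<le> length w"
  using length_foldr_push_le[of "map_letters \<phi> w" "[]"] by (simp add: free_map_def)

lemma free_map_eq_map_letters_if_length_eq:
  "length (free_map \<phi> w) = length w \<Longrightarrow> free_map \<phi> w = map_letters \<phi> w"
  unfolding free_map_def by (rule foldr_push_Nil_eq_if_length_eq) simp

section \<open>Cardinality of free groups\<close>

lemma infinite_free_group:
  assumes "X \<noteq> {}"
  shows "infinite (carrier (free_group X))"
proof -
  obtain a where a: "a \<in> X" using assms by blast
  have "reduced (replicate n (a, True))" for n
    by (auto simp: reduced_def successively_conv_nth inv_letter_def)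
  then have "range (\<lambda>n. replicate n (a, True)) \<subseteq> carrier (free_group X)"
    using a by (auto simp: carrier_free_group_iff)
  moreover have "infinite (range (\<lambda>n::nat. replicate n (a, True)))"
    by (rule range_inj_infinite) (auto intro!: injI simp: replicate_eq_replicate)
  ultimately show ?thesis using finite_subset by blast
qed

lemma card_of_free_group_countable:
  assumes "countable X" "X \<noteq> {}"
  shows "|carrier (free_group X)| =o natLeq"
proof -
  have "countable (lists (X \<times> (UNIV :: bool set)))" using assms(1) by blast
  then have "countable (carrier (free_group X))"
    by (rule countable_subset[rotated]) (auto simp: free_group_def)
  then have "|carrier (free_group X)| \<le>o natLeq" by (simp only: countable_card_le_natLeq)
  moreover have "natLeq \<le>o |carrier (free_group X)|"
    using infinite_free_group[OF assms(2)] infinite_iff_natLeq_ordLeq by blast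
  ultimately show ?thesis by (simp add: ordIso_iff_ordLeq)
qed

lemma card_of_free_group_infinite:
  assumes "infinite X"
  shows "|carrier (free_group X)| =o |X|"
proof -
  have "|carrier (free_group X)| \<le>o |lists (X \<times> (UNIV :: bool set))|"
    by (rule card_of_mono1) (auto simp: free_group_def)
  also have "|lists (X \<times> (UNIV :: bool set))| =o |X \<times> (UNIV :: bool set)|"
    using assms by (intro card_of_lists_infinite) (auto simp: finite_cartesian_product_iff)
  also have "|X \<times> (UNIV :: bool set)| =o |X|"
    using assms by (intro card_of_Times_infinite[THEN conjunct1])
      (auto intro: ordLess_imp_ordLeq finite_ordLess_infinite2)
  finally have "|carrier (free_group X)| \<le>o |X|" .
  moreover have "|X| \<le>o |carrier (free_group X)|"
    by (rule card_of_ordLeqI[of free_gen])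
      (auto intro: inj_on_subset[OF inj_free_gen] free_gen_closed)
  ultimately show ?thesis by (simp add: ordIso_iff_ordLeq)
qed

section \<open>Monotone functions on a directed set\<close>

lemma winning_strategy_II_if_cofinally_unbounded:
  fixes l :: "'i \<Rightarrow> nat"
  assumes "D \<noteq> {}" and mono: "monotone_on D leqD (\<le>) l"
    and "\<And>p n. p \<in> D \<Longrightarrow> \<exists>q\<in>D. leqD p q \<and> n < l q"
  shows "\<exists>s. winning_strategy_II D leqD s"
proof -
  obtain d where d: "d \<in> D" using assms(1) by blast
  obtain answer where answer: "\<And>p n. p \<in> D \<Longrightarrow> answer p n \<in> D"
    "\<And>p n. p \<in> D \<Longrightarrow> leqD p (answer p n)" "\<And>p n. p \<in> D \<Longrightarrow> n < l (answer p n)"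
    using assms(3) by metis
  define s where "s ps = answer (last (d # ps)) (length ps)" for ps
  have "winning_strategy_II D leqD s"
    unfolding winning_strategy_II_def
  proof (intro conjI allI impI notI)
    have "last (d # ps) \<in> D" if "ps \<in> lists D" for ps using that d by auto
    then show "s \<in> lists D \<rightarrow> D" using answer(1) by (simp add: s_def)
  next
    fix p assume p: "\<forall>i. p i \<in> D" and play: "\<forall>i. s (map p [0..<2 * i + 1]) = p (2 * i + 1)"
      and I_wins: "player_I_wins D leqD p"
    have move: "p (2 * i + 1) = answer (p (2 * i)) (2 * i + 1)" for i
      using play[rule_format, of i] by (simp add: s_def)
    then have "leqD (p (2 * i)) (p (2 * i + 1))" for i using answer(2) p by simp
    then obtain q where q: "q \<in> D" "\<forall>i. leqD (p i) q"
      using I_wins unfolding player_I_wins_def by blast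
    have "2 * l q + 1 < l (p (2 * l q + 1))" unfolding move using answer(3) p by blast
    also have "\<dots> \<le> l q" using monotone_onD[OF mono] p q by blast
    finally show False by simp
  qed
  then show ?thesis by blast
qed

locale directed =
  fixes D :: "'i set" and leqD :: "'i \<Rightarrow> 'i \<Rightarrow> bool"  (infix \<open>\<preceq>\<close> 50)
  assumes directed: "directed_set D leqD"
begin

lemma nonempty: "D \<noteq> {}"
  using directed by (simp add: directed_set_def)

lemma upper_bound:
  assumes "p \<in> D" "q \<in> D" obtains r where "r \<in> D" "p \<preceq> r" "q \<preceq> r"
  using assms directed unfolding directed_set_def by blast

lemma leqD_refl: "p \<in> D \<Longrightarrow> p \<preceq> p"
  using directed unfolding directed_set_def by (auto dest: reflp_onD)

lemma leqD_trans: "p \<preceq> q \<Longrightarrow> q \<preceq> r \<Longrightarrow> p \<in> D \<Longrightarrow> q \<in> D \<Longrightarrow> r \<in> D \<Longrightarrow> p \<preceq> r"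
  using directed unfolding directed_set_def by (auto dest: transp_onD)

lemma monotone_attains_max_if_no_winning_strategy_II:
  fixes l :: "'i \<Rightarrow> nat"
  assumes no: "\<not> (\<exists>s. winning_strategy_II D leqD s)" and mono: "monotone_on D leqD (\<le>) l"
  shows "\<exists>m\<in>D. \<forall>p\<in>D. l p \<le> l m"
proof -
  obtain p n where p: "p \<in> D" and bound: "\<And>q. q \<in> D \<Longrightarrow> p \<preceq> q \<Longrightarrow> l q \<le> n"
    using winning_strategy_II_if_cofinally_unbounded[OF nonempty mono] no not_less by metis
  have "l q \<le> n" if q: "q \<in> D" for q
  proof -
    obtain r where r: "r \<in> D" "p \<preceq> r" "q \<preceq> r" using upper_bound[OF p q] .
    have "l q \<le> l r" using monotone_onD[OF mono] q r by blast
    with bound[OF r(1,2)] show ?thesis by simp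
  qed
  then show ?thesis
    using ex_has_greatest_nat[of "\<lambda>q. q \<in> D" p l "Suc n"] p by (auto simp: less_Suc_eq_le)
qed

definition tails :: "'i filter" where
  "tails = (INF p\<in>D. principal {q \<in> D. p \<preceq> q})"

lemma eventually_tails: "eventually P tails \<longleftrightarrow> (\<exists>p\<in>D. \<forall>q\<in>D. p \<preceq> q \<longrightarrow> P q)"
  unfolding tails_def
proof (subst eventually_INF_base[OF nonempty])
  fix p q assume pq: "p \<in> D" "q \<in> D"
  obtain r where r: "r \<in> D" "p \<preceq> r" "q \<preceq> r" using upper_bound[OF pq] .
  then show "\<exists>r\<in>D. principal {s \<in> D. r \<preceq> s}
      \<le> inf (principal {s \<in> D. p \<preceq> s}) (principal {s \<in> D. q \<preceq> s})"
    using pq leqD_trans by (intro bexI[of _ r]) auto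
qed (auto simp: eventually_principal)

lemma eventually_tailsE:
  assumes "eventually P tails" obtains p where "p \<in> D" "P p"
  using assms leqD_refl unfolding eventually_tails by blast

lemma eventually_tailsI: "p \<in> D \<Longrightarrow> (\<And>q. q \<in> D \<Longrightarrow> p \<preceq> q \<Longrightarrow> P q) \<Longrightarrow> eventually P tails"
  unfolding eventually_tails by blast

end

section \<open>Inverse limits\<close>

lemma inverse_limit_set_component:
  "a \<in> inverse_limit_set D leqD A f \<Longrightarrow> p \<in> D \<Longrightarrow> a p \<in> A p"
  by (auto simp: inverse_limit_set_def)

lemma inverse_limit_set_extensional:
  "a \<in> inverse_limit_set D leqD A f \<Longrightarrow> a \<in> extensional D"
  by (auto simp: inverse_limit_set_def PiE_iff)

lemma inverse_limit_set_compatible: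
  "a \<in> inverse_limit_set D leqD A f \<Longrightarrow> p \<in> D \<Longrightarrow> q \<in> D \<Longrightarrow> leqD p q \<Longrightarrow> f p q (a q) = a p"
  by (auto simp: inverse_limit_set_def)

lemma inverse_limit_set_cong:
  assumes "\<And>p q a. p \<in> D \<Longrightarrow> q \<in> D \<Longrightarrow> leqD p q \<Longrightarrow> a \<in> A q \<Longrightarrow> f p q a = f' p q a"
  shows "inverse_limit_set D leqD A f = inverse_limit_set D leqD A f'"
  using assms by (auto simp: inverse_limit_set_def PiE_iff)

lemma carrier_inverse_limit_group:
  "carrier (inverse_limit_group D leqD G h) = inverse_limit_set D leqD (\<lambda>p. carrier (G p)) h"
  by (simp add: inverse_limit_group_def inverse_limit_set_def)

lemma mult_inverse_limit_group:
  "g \<otimes>\<^bsub>inverse_limit_group D leqD G h\<^esub> g' = (\<lambda>p\<in>D. g p \<otimes>\<^bsub>G p\<^esub> g' p)"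
  by (simp add: inverse_limit_group_def)

lemma group_inverse_limit_group:
  assumes G: "\<And>p. p \<in> D \<Longrightarrow> group (G p)"
    and h: "\<And>p q. p \<in> D \<Longrightarrow> q \<in> D \<Longrightarrow> leqD p q \<Longrightarrow> h p q \<in> hom (G q) (G p)"
  shows "group (inverse_limit_group D leqD G h)"
proof -
  let ?P = "product_group D G"
  let ?H = "{g \<in> carrier ?P. \<forall>p\<in>D. \<forall>q\<in>D. leqD p q \<longrightarrow> h p q (g q) = g p}"
  interpret P: group ?P using G by (rule product_group)
  have hom: "group_hom (G q) (G p) (h p q)" if "p \<in> D" "q \<in> D" "leqD p q" for p q
    using that G h by (simp add: group_hom_def group_hom_axioms_def)
  have "subgroup ?H ?P"
  proof (rule P.subgroupI)
    have "\<one>\<^bsub>?P\<^esub> \<in> ?H"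
      using P.one_closed by (auto simp: group_hom.hom_one[OF hom])
    then show "?H \<noteq> {}" by blast
  next
    fix g assume "g \<in> ?H"
    then show "inv\<^bsub>?P\<^esub> g \<in> ?H"
      using P.inv_closed[of g] G by (auto simp: PiE_iff group_hom.hom_inv[OF hom])
  next
    fix g g' assume "g \<in> ?H" "g' \<in> ?H"
    then show "g \<otimes>\<^bsub>?P\<^esub> g' \<in> ?H"
      using P.m_closed[of g g'] by (auto simp: PiE_iff group_hom.hom_mult[OF hom])
  qed auto
  then show ?thesis
    unfolding inverse_limit_group_def by (rule subgroup.subgroup_is_group) (rule P.is_group)
qed

context directed
begin

lemma eventually_neq_inverse_limit_set:
  assumes a: "a \<in> inverse_limit_set D leqD A f" and b: "b \<in> inverse_limit_set D leqD A f"
    and "a \<noteq> b"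
  shows "\<forall>\<^sub>F p in tails. a p \<noteq> b p"
proof -
  obtain p where p: "p \<in> D" "a p \<noteq> b p"
    using \<open>a \<noteq> b\<close> inverse_limit_set_extensional[OF a] inverse_limit_set_extensional[OF b]
      extensionalityI[of a D b] by blast
  show ?thesis
  proof (rule eventually_tailsI[OF p(1)])
    fix q assume q: "q \<in> D" "p \<preceq> q"
    show "a q \<noteq> b q"
      using p(2) inverse_limit_set_compatible[OF a p(1) q] inverse_limit_set_compatible[OF b p(1) q]
      by metis
  qed
qed

lemma eventually_inj_on_inverse_limit_set:
  assumes "finite S" "S \<subseteq> inverse_limit_set D leqD A f"
  shows "\<forall>\<^sub>F p in tails. inj_on (\<lambda>a. a p) S"
proof -
  have "\<forall>\<^sub>F p in tails. a p = b p \<longrightarrow> a = b" if "a \<in> S" "b \<in> S" for a b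
  proof (cases "a = b")
    case False
    have "\<forall>\<^sub>F p in tails. a p \<noteq> b p"
      using that assms(2) False by (blast intro: eventually_neq_inverse_limit_set)
    then show ?thesis by eventually_elim blast
  qed simp
  then show ?thesis
    unfolding inj_on_def using assms(1) by (intro eventually_ball_finite ballI)
qed

lemma inverse_limit_set_eqI:
  assumes "a \<in> inverse_limit_set D leqD A f" "b \<in> inverse_limit_set D leqD A f"
    and eq: "\<forall>\<^sub>F p in tails. a p = b p"
  shows "a = b"
proof (rule ccontr)
  assume "a \<noteq> b"
  with assms(1,2) have "\<forall>\<^sub>F p in tails. a p \<noteq> b p"
    by (rule eventually_neq_inverse_limit_set)
  with eq have "\<forall>\<^sub>F p in tails. False" by eventually_elim simp
  then show False by (rule eventually_tailsE)
qed

end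

locale inverse_system = directed D leqD
  for D :: "'i set" and leqD :: "'i \<Rightarrow> 'i \<Rightarrow> bool"  (infix \<open>\<preceq>\<close> 50) +
  fixes A :: "'i \<Rightarrow> 'a set" and f :: "'i \<Rightarrow> 'i \<Rightarrow> 'a \<Rightarrow> 'a"
  assumes system: "inverse_system_sets D leqD A f"
begin

abbreviation lim_set :: "('i \<Rightarrow> 'a) set" where
  "lim_set \<equiv> inverse_limit_set D leqD A f"

lemma bond_closed: "p \<in> D \<Longrightarrow> q \<in> D \<Longrightarrow> p \<preceq> q \<Longrightarrow> f p q \<in> A q \<rightarrow> A p"
  using system unfolding inverse_system_sets_def by blast

lemma bond_comp:
  "p \<in> D \<Longrightarrow> q \<in> D \<Longrightarrow> r \<in> D \<Longrightarrow> p \<preceq> q \<Longrightarrow> q \<preceq> r \<Longrightarrow> a \<in> A r \<Longrightarrow> f p q (f q r a) = f p r a"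
  using system unfolding inverse_system_sets_def by blast

lemma bond_tail_independent:
  assumes m: "m \<in> D" and b: "b \<in> inverse_limit_set {p \<in> D. m \<preceq> p} leqD A f"
    and p: "p \<in> D" and s: "s \<in> D" "p \<preceq> s" "m \<preceq> s" and t: "t \<in> D" "p \<preceq> t" "m \<preceq> t"
  shows "f p s (b s) = f p t (b t)"
proof -
  have to_bound: "f p r (b r) = f p u (b u)"
    if r: "r \<in> D" "p \<preceq> r" "m \<preceq> r" and u: "u \<in> D" "r \<preceq> u" for r u
  proof -
    have "m \<preceq> u" using leqD_trans r u m by blast
    then have "b u \<in> A u" "f r u (b u) = b r"
      using inverse_limit_set_component[OF b] inverse_limit_set_compatible[OF b] r u by simp_all
    then show ?thesis using bond_comp[of p r u "b u"] p r u by simp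
  qed
  obtain u where "u \<in> D" "s \<preceq> u" "t \<preceq> u" using upper_bound[OF s(1) t(1)] .
  then show ?thesis using to_bound s t by simp
qed

lemma inverse_limit_set_tail_extends:
  assumes m: "m \<in> D" and b: "b \<in> inverse_limit_set {p \<in> D. m \<preceq> p} leqD A f"
  obtains a where "a \<in> lim_set" "\<And>p. p \<in> D \<Longrightarrow> m \<preceq> p \<Longrightarrow> a p = b p"
proof -
  have "\<forall>p\<in>D. \<exists>r\<in>D. p \<preceq> r \<and> m \<preceq> r" using upper_bound m by blast
  then obtain r where r: "\<And>p. p \<in> D \<Longrightarrow> r p \<in> D" "\<And>p. p \<in> D \<Longrightarrow> p \<preceq> r p"
    "\<And>p. p \<in> D \<Longrightarrow> m \<preceq> r p" by metis
  define a where "a = (\<lambda>p\<in>D. f p (r p) (b (r p)))"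
  have a_eq: "a p = f p s (b s)" if "p \<in> D" "s \<in> D" "p \<preceq> s" "m \<preceq> s" for p s
    using bond_tail_independent[OF m b that(1) r[OF that(1)] that(2-4)] that(1)
    by (simp add: a_def)
  have br: "b (r p) \<in> A (r p)" if "p \<in> D" for p
    using inverse_limit_set_component[OF b] r that by simp
  have "f p q (a q) = a p" if pq: "p \<in> D" "q \<in> D" "p \<preceq> q" for p q
  proof -
    have "p \<preceq> r q" using leqD_trans r pq by blast
    then have "a p = f p (r q) (b (r q))" using a_eq r pq by blast
    also have "\<dots> = f p q (a q)" using bond_comp[of p q "r q"] br r pq by (simp add: a_def)
    finally show ?thesis by simp
  qed
  moreover have "a p \<in> A p" if "p \<in> D" for p
    using bond_closed[of p "r p"] br r that by (auto simp: a_def)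
  ultimately have "a \<in> lim_set" by (auto simp: inverse_limit_set_def a_def)
  moreover have "a p = b p" if "p \<in> D" "m \<preceq> p" for p
    using a_eq[of p p] inverse_limit_set_compatible[OF b, of p p] that leqD_refl by simp
  ultimately show thesis using that by blast
qed

section \<open>The limit of the free groups\<close>

abbreviation lim_group :: "('i \<Rightarrow> ('a \<times> bool) list) monoid" where
  "lim_group \<equiv> inverse_limit_group D leqD (gr_obj A) (gr_map A f)"

lemma gr_map_eq_free_map:
  assumes "p \<in> D" "q \<in> D" "p \<preceq> q" "w \<in> carrier (free_group (A q))"
  shows "gr_map A f p q w = free_map (f p q) w"
  unfolding gr_map_def gr_obj_def
  by (rule free_map_eq_free_lift[OF bond_closed[OF assms(1-3)] assms(4), symmetric])

lemma carrier_lim_group: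
  "carrier lim_group =
    inverse_limit_set D leqD (\<lambda>p. carrier (free_group (A p))) (\<lambda>p q. free_map (f p q))"
  unfolding carrier_inverse_limit_group gr_obj_def
  by (rule inverse_limit_set_cong) (rule gr_map_eq_free_map)

lemma lim_group_component:
  "g \<in> carrier lim_group \<Longrightarrow> p \<in> D \<Longrightarrow> g p \<in> carrier (free_group (A p))"
  unfolding carrier_lim_group by (rule inverse_limit_set_component)

lemma lim_group_compatible:
  "g \<in> carrier lim_group \<Longrightarrow> p \<in> D \<Longrightarrow> q \<in> D \<Longrightarrow> p \<preceq> q \<Longrightarrow> free_map (f p q) (g q) = g p"
  unfolding carrier_lim_group by (rule inverse_limit_set_compatible)

lemma lim_group_eqI:
  assumes "g \<in> carrier lim_group" "h \<in> carrier lim_group" "\<forall>\<^sub>F p in tails. g p = h p"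
  shows "g = h"
  using assms unfolding carrier_lim_group by (rule inverse_limit_set_eqI)

lemma group_lim_group: "group lim_group"
proof (rule group_inverse_limit_group)
  fix p q assume pq: "p \<in> D" "q \<in> D" "p \<preceq> q"
  have "(\<lambda>a. free_gen (f p q a)) \<in> A q \<rightarrow> carrier (free_group (A p))"
    using bond_closed[OF pq] by (auto intro!: free_gen_closed)
  then show "gr_map A f p q \<in> hom (gr_obj A q) (gr_obj A p)"
    unfolding gr_map_def gr_obj_def by (rule group.free_lift_hom[OF group_free_group])
qed (simp add: gr_obj_def group_free_group)

definition comparison :: "(('i \<Rightarrow> 'a) \<times> bool) list \<Rightarrow> 'i \<Rightarrow> ('a \<times> bool) list" where
  "comparison w = (\<lambda>p\<in>D. free_map (\<lambda>a. a p) w)"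

lemma comparison_closed:
  assumes w: "w \<in> carrier (free_group lim_set)"
  shows "comparison w \<in> carrier lim_group"
proof -
  have "free_map (\<lambda>a. a p) w \<in> carrier (free_group (A p))" if "p \<in> D" for p
    by (rule free_map_closed[OF _ w]) (auto intro: inverse_limit_set_component that)
  moreover have "free_map (f p q) (free_map (\<lambda>a. a q) w) = free_map (\<lambda>a. a p) w"
    if pq: "p \<in> D" "q \<in> D" "p \<preceq> q" for p q
    unfolding free_map_comp
  proof (rule free_map_cong)
    fix a assume "a \<in> fst ` set w"
    then have "a \<in> lim_set" using w by (auto simp: carrier_free_group_iff)
    then show "f p q (a q) = a p" using pq by (rule inverse_limit_set_compatible)
  qed
  ultimately show ?thesis
    by (simp add: carrier_lim_group inverse_limit_set_def comparison_def)
qed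

lemma comparison_hom: "comparison \<in> hom (free_group lim_set) lim_group"
  by (rule homI, rule comparison_closed)
    (auto simp: comparison_def mult_inverse_limit_group gr_obj_def mult_free_group
      free_map_foldr_push)

lemma inj_on_comparison: "inj_on comparison (carrier (free_group lim_set))"
proof (rule inj_onI)
  fix u v assume uv: "u \<in> carrier (free_group lim_set)" "v \<in> carrier (free_group lim_set)"
    and eq: "comparison u = comparison v"
  let ?S = "fst ` set u \<union> fst ` set v"
  have "?S \<subseteq> lim_set" using uv by (simp add: carrier_free_group_iff)
  then have "\<forall>\<^sub>F p in tails. inj_on (\<lambda>a. a p) ?S"
    by (intro eventually_inj_on_inverse_limit_set) simp_all
  then obtain p where p: "p \<in> D" and inj: "inj_on (\<lambda>a. a p) ?S" by (rule eventually_tailsE)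
  have "free_map (\<lambda>a. a p) u = free_map (\<lambda>a. a p) v"
    using fun_cong[OF eq, of p] p by (simp add: comparison_def)
  moreover have "u \<in> carrier (free_group ?S)" "v \<in> carrier (free_group ?S)"
    using uv by (auto simp: carrier_free_group_iff)
  ultimately show "u = v" using inj_onD[OF inj_on_free_map[OF inj]] by blast
qed

lemma monotone_length:
  assumes "g \<in> carrier lim_group"
  shows "monotone_on D leqD (\<le>) (\<lambda>p. length (g p))"
proof (rule monotone_onI)
  fix p q assume "p \<in> D" "q \<in> D" "p \<preceq> q"
  then show "length (g p) \<le> length (g q)"
    using lim_group_compatible[OF assms, of p q]
      length_free_map_le[of "f p q" "g q"] by simp
qed

context
  fixes g m
  assumes g: "g \<in> carrier lim_group" and m: "m \<in> D"
    and max: "\<And>p. p \<in> D \<Longrightarrow> length (g p) \<le> length (g m)"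
begin

lemma length_eq_beyond_max: "p \<in> D \<Longrightarrow> m \<preceq> p \<Longrightarrow> length (g p) = length (g m)"
  using max monotone_onD[OF monotone_length[OF g] m] by (simp add: order_antisym)

lemma map_letters_beyond_max:
  assumes "p \<in> D" "q \<in> D" "m \<preceq> p" "p \<preceq> q"
  shows "map_letters (f p q) (g q) = g p"
proof -
  have "m \<preceq> q" using leqD_trans assms m by blast
  then have "length (g p) = length (g q)" using length_eq_beyond_max assms by simp
  moreover have "free_map (f p q) (g q) = g p"
    using lim_group_compatible[OF g] assms by blast
  ultimately show ?thesis using free_map_eq_map_letters_if_length_eq[of "f p q" "g q"] by simp
qed

lemma bond_letter_beyond_max:
  assumes k: "k < length (g m)" and pq: "p \<in> D" "q \<in> D" "m \<preceq> p" "p \<preceq> q"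
  shows "map_prod (f p q) id (g q ! k) = g p ! k"
proof -
  have "m \<preceq> q" using leqD_trans pq m by blast
  then have "k < length (g q)" using k length_eq_beyond_max pq by simp
  then have "map_prod (f p q) id (g q ! k) = map_letters (f p q) (g q) ! k" by simp
  then show ?thesis using map_letters_beyond_max[OF pq] by simp
qed

lemma letter_traces_inverse_limit:
  assumes k: "k < length (g m)"
  shows "\<exists>x. fst x \<in> lim_set \<and> (\<forall>p\<in>D. m \<preceq> p \<longrightarrow> map_prod (\<lambda>a. a p) id x = g p ! k)"
proof -
  let ?T = "{p \<in> D. m \<preceq> p}"
  have "fst (g p ! k) \<in> A p" if "p \<in> ?T" for p
  proof -
    have "g p ! k \<in> set (g p)" using k that length_eq_beyond_max by simp
    then show ?thesis
      using lim_group_component[OF g, of p] that by (auto simp: carrier_free_group_iff)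
  qed
  moreover have "f p q (fst (g q ! k)) = fst (g p ! k)" if "p \<in> ?T" "q \<in> ?T" "p \<preceq> q" for p q
    using bond_letter_beyond_max[OF k, of p q, symmetric] that by simp
  ultimately have "(\<lambda>p\<in>?T. fst (g p ! k)) \<in> inverse_limit_set ?T leqD A f"
    by (simp add: inverse_limit_set_def)
  from inverse_limit_set_tail_extends[OF m this]
  obtain a where a: "a \<in> lim_set" "\<And>p. p \<in> D \<Longrightarrow> m \<preceq> p \<Longrightarrow> a p = fst (g p ! k)" by auto
  have "snd (g m ! k) = snd (g p ! k)" if "p \<in> D" "m \<preceq> p" for p
    using bond_letter_beyond_max[OF k m that(1) leqD_refl[OF m] that(2), symmetric] by simp
  with a show ?thesis
    by (intro exI[of _ "(a, snd (g m ! k))"]) (simp add: prod_eq_iff)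
qed

lemma mem_image_comparison: "g \<in> comparison ` carrier (free_group lim_set)"
proof -
  obtain w where len: "length w = length (g m)"
    and letters: "\<And>k. k < length (g m) \<Longrightarrow> fst (w ! k) \<in> lim_set"
      "\<And>k p. k < length (g m) \<Longrightarrow> p \<in> D \<Longrightarrow> m \<preceq> p \<Longrightarrow>
        map_prod (\<lambda>a. a p) id (w ! k) = g p ! k"
    using letter_traces_inverse_limit Skolem_list_nth[of "length (g m)"
        "\<lambda>k x. fst x \<in> lim_set \<and> (\<forall>p\<in>D. m \<preceq> p \<longrightarrow> map_prod (\<lambda>a. a p) id x = g p ! k)"]
    by blast
  have eval: "map_letters (\<lambda>a. a p) w = g p" if "p \<in> D" "m \<preceq> p" for p
    using len letters(2) length_eq_beyond_max that by (intro nth_equalityI) simp_all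
  have red: "reduced (g p)" if "p \<in> D" for p
    using lim_group_component[OF g that] by (simp add: carrier_free_group_iff)
  then have "reduced w" using eval reduced_map_lettersD m leqD_refl by metis
  then have w: "w \<in> carrier (free_group lim_set)"
    using len letters(1) by (fastforce simp: carrier_free_group_iff in_set_conv_nth)
  have "free_map (\<lambda>a. a p) w = g p" if "p \<in> D" "m \<preceq> p" for p
    using free_map_eq_map_letters[of "\<lambda>a. a p" w] eval[OF that] red[OF that(1)] by simp
  then have "\<forall>\<^sub>F p in tails. g p = comparison w p"
    using m by (intro eventually_tailsI[of m]) (simp_all add: comparison_def)
  then have "g = comparison w"
    by (rule lim_group_eqI[OF g comparison_closed[OF w]])
  then show ?thesis using w by (rule image_eqI)
qed

end

lemma comparison_iso:
  assumes "\<not> (\<exists>s. winning_strategy_II D leqD s)"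
  shows "comparison \<in> iso (free_group lim_set) lim_group"
proof (rule isoI[OF comparison_hom])
  have "g \<in> comparison ` carrier (free_group lim_set)" if g: "g \<in> carrier lim_group" for g
    using monotone_attains_max_if_no_winning_strategy_II[OF assms monotone_length[OF g]]
      mem_image_comparison[OF g] by blast
  then show "bij_betw comparison (carrier (free_group lim_set)) (carrier lim_group)"
    using inj_on_comparison comparison_closed by (auto simp: bij_betw_def)
qed

end

theorem theorem3p1:
  fixes D :: "'i set" and leqD :: "'i \<Rightarrow> 'i \<Rightarrow> bool"
    and A :: "'i \<Rightarrow> 'a set" and f :: "'i \<Rightarrow> 'i \<Rightarrow> 'a \<Rightarrow> 'a"
  assumes "directed_set D leqD"
    and "\<not> (\<exists>s. winning_strategy_II D leqD s)"
    and "inverse_system_sets D leqD A f"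
    and "inverse_limit_set D leqD A f \<noteq> {}"
  shows "is_free_group (inverse_limit_group D leqD (gr_obj A) (gr_map A f)) \<and>
    (if |inverse_limit_set D leqD A f| \<le>o natLeq
     then |carrier (inverse_limit_group D leqD (gr_obj A) (gr_map A f))| =o natLeq
     else |carrier (inverse_limit_group D leqD (gr_obj A) (gr_map A f))|
            =o |inverse_limit_set D leqD A f| )"
proof -
  interpret inverse_system D leqD A f using assms(1,3) by unfold_locales
  have iso: "comparison \<in> iso (free_group lim_set) lim_group"
    by (rule comparison_iso[OF assms(2)])
  then have card: "|carrier lim_group| =o |carrier (free_group lim_set)|"
    by (auto simp: iso_def intro: card_of_ordIsoI ordIso_symmetric)
  have "is_free_group lim_group" using group_lim_group iso by (rule is_free_group_if_iso)
  moreover have "|carrier lim_group| =o natLeq" if "|lim_set| \<le>o natLeq"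
    using that card_of_free_group_countable[OF _ assms(4)] card ordIso_transitive
    unfolding countable_card_le_natLeq by blast
  moreover have "|carrier lim_group| =o |lim_set|" if "\<not> |lim_set| \<le>o natLeq"
  proof -
    have "infinite lim_set" using that countable_finite countable_card_le_natLeq by blast
    then show ?thesis using card card_of_free_group_infinite ordIso_transitive by blast
  qed
  ultimately show ?thesis by simp
qed

end
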